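(* Let $\mathbb{K}$ be a field and let $\mathcal{A}=(V,\mu,\eta,\alpha)$ be a unital hom-associative algebra over $\mathbb{K}$, where $e_2:=\eta(1)$ is the unit. Let $\tilde V=\mathrm{span}(V,e_1)$ be the vector space spanned by $V$ and a new vector $e_1$ (so $\tilde V=V\oplus\mathbb{K}e_1$). Then $\mathcal{K}_1(\mathcal{A}):=(\tilde V,\mu_1,\eta_1,\Delta_1,\varepsilon_1,\alpha_1)$ is a unital hom-bialgebra, where: - the multiplication $\mu_1$ is defined by $\mu_1(e_1\otimes x)=\mu_1(x\otimes e_1)=x$ for all $x\in\tilde V$, and $\mu_1(x\otimes y)=\mu(x\otimes y)$ for all $x,y\in V$; - the unit $\eta_1$ is given by $\eta_1(1)=e_1$; - the comultiplication $\Delta_1$ is defined by $\Delta_1(e_1)=e_1\otimes e_1$ and $\Delta_1(x)=\alpha(x)\otimes e_1+e_1\otimes\alpha(x)-e_2\otimes\alpha(x)$ for all $x\in V$; - the counit $\varepsilon_1$ is defined by $\varepsilon_1(e_1)=1$ and $\varepsilon_1(x)=0$ for all $x\in V$; - the linear map $\alpha_1$ is defined by $\alpha_1(e_1)=e_1$, $\alpha_1(e_2)=e_2$, and $\alpha_1(x)=\alpha(x)$ for all $x\in V$.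
   Context: All spaces are over a field $\mathbb{K}$ and all structure maps are linear. A hom-associative algebra $(V,\mu,\alpha)$ is a vector space $V$ with a bilinear map $\mu:V\times V\to V$ and a linear map $\alpha:V\to V$ such that $\alpha\circ\mu=\mu\circ(\alpha\otimes\alpha)$ (multiplicativity) and $\mu\circ(\alpha\otimes\mu)=\mu\circ(\mu\otimes\alpha)$ (hom-associativity). It is unital, written $(V,\mu,\eta,\alpha)$, if there is $e\in V$ with $\mu(x,e)=\mu(e,x)=x$ for all $x\in V$; here $\eta:\mathbb{K}\to V$ is $\eta(c)=ce$. A hom-coassociative coalgebra $(V,\Delta,\alpha)$ is a vector space $V$ with linear maps $\Delta:V\to V\otimes V$ and $\alpha:V\to V$ such that $(\alpha\otimes\alpha)\circ\Delta=\Delta\circ\alpha$ and $(\alpha\otimes\Delta)\circ\Delta=(\Delta\otimes\alpha)\circ\Delta$. It is counital, written $(V,\Delta,\varepsilon,\alpha)$, if it is equipped with a linear map $\varepsilon:V\to\mathbb{K}$ satisfying $(\varepsilon\otimes\alpha)\Delta(x)=(\alpha\otimes\varepsilon)\Delta(x)=\alpha^2(x)$ for all $x\in V$ (identifying $\mathbb{K}\otimes V=V=V\otimes\mathbb{K}$). A unital hom-bialgebra is a system $(V,\mu,\eta,\Delta,\varepsilon,\alpha)$ such that $(V,\mu,\eta,\alpha)$ is a unital hom-associative algebra, $(V,\Delta,\varepsilon,\alpha)$ is a counital hom-coassociative coalgebra, and for all $x,y\in V$: $\Delta(\mu(x\otimes y))=\Delta(x)\bullet\Delta(y)$, $(\alpha\otimes\alpha)\circ\Delta=\Delta\circ\alpha$,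 $\varepsilon(\mu(x\otimes y))=\varepsilon(x)\varepsilon(y)$, and $\varepsilon\circ\alpha(x)=\varepsilon(x)$, where $(x\otimes y)\bullet(x'\otimes y')=\mu(x\otimes x')\otimes\mu(y\otimes y')$.
   Formalization: The condition α(e₂)=e₂, implicit in the clauses α₁(e₂)=e₂ and α₁(x)=α(x) on V, is an explicit hypothesis; without it α₁ is not well defined (e.g. V=𝕂, α=0) and 𝒦₁(𝒜) is not hom-associative. *)

theory Defs
  imports "HOL-Analysis.Product_Vector" "HOL-Library.Function_Algebras"
begin

section \<open>Tensor products of vector spaces over an arbitrary field\<close>

text \<open>
  The tensor product of vector spaces \<open>V\<close> and \<open>W\<close> is realised inside the dual of the space of
  bilinear forms on \<open>V \<times> W\<close>: the pure tensor \<open>x \<otimes> y\<close> is evaluation at \<open>(x, y)\<close>, and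
  \<open>V \<otimes> W\<close> is the span of the pure tensors. The lemmas \<open>bilinear_on_tens\<close>,
  \<open>tensor_universal\<close> and \<open>tensor_linear_unique\<close> show that this has the universal property.

  \<open>V\<close> and \<open>W\<close> are given by carrier sets \<open>S\<close>, \<open>T\<close> with scalar multiplications \<open>s1\<close>, \<open>s2\<close>;
  the carriers are needed to iterate the construction, since \<open>V \<otimes> W\<close> is a proper subset of its
  type.
\<close>

definition linear_on :: "'v set \<Rightarrow> ('k \<Rightarrow> 'v \<Rightarrow> 'v) \<Rightarrow> ('k \<Rightarrow> 'w \<Rightarrow> 'w)
    \<Rightarrow> ('v::ab_group_add \<Rightarrow> 'w::ab_group_add) \<Rightarrow> bool"
  where "linear_on S s1 s2 f \<longleftrightarrow>
    (\<forall>x\<in>S. \<forall>y\<in>S. f (x + y) = f x + f y) \<and> (\<forall>c. \<forall>x\<in>S. f (s1 c x) = s2 c (f x))"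

definition bilinear_on :: "'v set \<Rightarrow> ('k \<Rightarrow> 'v \<Rightarrow> 'v) \<Rightarrow> 'w set \<Rightarrow> ('k \<Rightarrow> 'w \<Rightarrow> 'w)
    \<Rightarrow> ('k \<Rightarrow> 'u \<Rightarrow> 'u) \<Rightarrow> ('v::ab_group_add \<Rightarrow> 'w::ab_group_add \<Rightarrow> 'u::ab_group_add) \<Rightarrow> bool"
  where "bilinear_on S s1 T s2 s3 h \<longleftrightarrow>
    (\<forall>x\<in>S. linear_on T s2 s3 (h x)) \<and> (\<forall>y\<in>T. linear_on S s1 s3 (\<lambda>x. h x y))"

type_synonym ('v, 'w, 'k) tensor = "('v \<Rightarrow> 'w \<Rightarrow> 'k) \<Rightarrow> 'k"

definition tscale :: "'k::field \<Rightarrow> ('a \<Rightarrow> 'k) \<Rightarrow> 'a \<Rightarrow> 'k"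
  where "tscale c t = (\<lambda>\<beta>. c * t \<beta>)"

text \<open>Every element of the tensor product vanishes at functions which are not bilinear forms;
  this makes equality of tensors equality of functionals on the bilinear forms.\<close>

definition tens :: "'v::ab_group_add set \<Rightarrow> ('k \<Rightarrow> 'v \<Rightarrow> 'v) \<Rightarrow> 'w::ab_group_add set
    \<Rightarrow> ('k \<Rightarrow> 'w \<Rightarrow> 'w) \<Rightarrow> 'v \<Rightarrow> 'w \<Rightarrow> ('v, 'w, 'k::field) tensor"
  where "tens S s1 T s2 x y = (\<lambda>\<beta>. if bilinear_on S s1 T s2 (*) \<beta> then \<beta> x y else 0)"

definition tensor_space :: "'v::ab_group_add set \<Rightarrow> ('k \<Rightarrow> 'v \<Rightarrow> 'v) \<Rightarrow> 'w::ab_group_add set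
    \<Rightarrow> ('k \<Rightarrow> 'w \<Rightarrow> 'w) \<Rightarrow> ('v, 'w, 'k::field) tensor set"
  where "tensor_space S s1 T s2 = module.span tscale {tens S s1 T s2 x y | x y. x \<in> S \<and> y \<in> T}"

text \<open>\<open>f \<otimes> g\<close>, as the transpose of the pullback of bilinear forms along \<open>f \<times> g\<close>. The arguments
  \<open>S s1 T s2\<close> describe the codomains of \<open>f\<close> and \<open>g\<close>; see \<open>tensor_map_tens\<close>.\<close>

definition tensor_map :: "'v2::ab_group_add set \<Rightarrow> ('k \<Rightarrow> 'v2 \<Rightarrow> 'v2) \<Rightarrow> 'w2::ab_group_add set
    \<Rightarrow> ('k \<Rightarrow> 'w2 \<Rightarrow> 'w2) \<Rightarrow> ('v \<Rightarrow> 'v2) \<Rightarrow> ('w \<Rightarrow> 'w2)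
    \<Rightarrow> ('v, 'w, 'k::field) tensor \<Rightarrow> ('v2, 'w2, 'k) tensor"
  where "tensor_map S s1 T s2 f g t =
    (\<lambda>\<beta>. if bilinear_on S s1 T s2 (*) \<beta> then t (\<lambda>x y. \<beta> (f x) (g y)) else 0)"

text \<open>The canonical map \<open>(U \<otimes> V) \<otimes> W \<rightarrow> U \<otimes> (V \<otimes> W)\<close>; see \<open>tensor_assoc_tens\<close>.\<close>

definition tensor_assoc :: "'u::ab_group_add set \<Rightarrow> ('k \<Rightarrow> 'u \<Rightarrow> 'u) \<Rightarrow> 'v::ab_group_add set
    \<Rightarrow> ('k \<Rightarrow> 'v \<Rightarrow> 'v) \<Rightarrow> 'w::ab_group_add set \<Rightarrow> ('k \<Rightarrow> 'w \<Rightarrow> 'w)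
    \<Rightarrow> (('u, 'v, 'k) tensor, 'w, 'k::field) tensor \<Rightarrow> ('u, ('v, 'w, 'k) tensor, 'k) tensor"
  where "tensor_assoc R s1 S s2 T s3 t =
    (\<lambda>\<beta>. if bilinear_on R s1 (tensor_space S s2 T s3) tscale (*) \<beta>
          then t (\<lambda>r z. r (\<lambda>x y. \<beta> x (tens S s2 T s3 y z))) else 0)"

text \<open>The product \<open>(x \<otimes> y) \<bullet> (x' \<otimes> y') = \<mu>(x, x') \<otimes> \<mu>(y, y')\<close> on \<open>V \<otimes> V\<close>; see
  \<open>tensor_mult_tens\<close>.\<close>

definition tensor_mult :: "('k \<Rightarrow> 'v \<Rightarrow> 'v) \<Rightarrow> ('v \<Rightarrow> 'v \<Rightarrow> 'v::ab_group_add)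
    \<Rightarrow> ('v, 'v, 'k::field) tensor \<Rightarrow> ('v, 'v, 'k) tensor \<Rightarrow> ('v, 'v, 'k) tensor"
  where "tensor_mult s mu t u =
    (\<lambda>\<beta>. if bilinear_on UNIV s UNIV s (*) \<beta>
          then t (\<lambda>x y. u (\<lambda>x' y'. \<beta> (mu x x') (mu y y'))) else 0)"


subsection \<open>Correctness of the tensor product\<close>

lemma vector_space_tscale: "vector_space (tscale :: 'k::field \<Rightarrow> ('a \<Rightarrow> 'k) \<Rightarrow> 'a \<Rightarrow> 'k)"
  apply unfold_locales
     apply (simp_all add: tscale_def)
   apply (simp_all add: fun_eq_iff algebra_simps)
  done

lemma bilinear_on_tens:
  "bilinear_on S s1 T s2 tscale (tens S s1 T s2)"
  unfolding bilinear_on_def linear_on_def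
  by (auto simp: tens_def tscale_def fun_eq_iff bilinear_on_def linear_on_def)

lemma tens_in_tensor_space: "x \<in> S \<Longrightarrow> y \<in> T \<Longrightarrow> tens S s1 T s2 x y \<in> tensor_space S s1 T s2"
proof -
  interpret vector_space "tscale :: 'c \<Rightarrow> (('a \<Rightarrow> 'b \<Rightarrow> 'c) \<Rightarrow> 'c) \<Rightarrow> _" by (rule vector_space_tscale)
  show "x \<in> S \<Longrightarrow> y \<in> T \<Longrightarrow> tens S s1 T s2 x y \<in> tensor_space S s1 T s2"
    unfolding tensor_space_def by (rule span_base) auto
qed

lemma tensor_linear_unique:
  assumes "Vector_Spaces.linear tscale s3 L" and "Vector_Spaces.linear tscale s3 L'"
    and "\<And>x y. x \<in> S \<Longrightarrow> y \<in> T \<Longrightarrow> L (tens S s1 T s2 x y) = L' (tens S s1 T s2 x y)"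
    and "t \<in> tensor_space S s1 T s2"
  shows "L t = L' t"
proof -
  interpret l: Vector_Spaces.linear tscale s3 L by fact
  interpret vector_space_pair tscale s3
    by (intro vector_space_pair.intro vector_space_tscale l.vs2.vector_space_axioms)
  show ?thesis
    by (rule linear_eq_on[OF assms(1,2)]) (use assms(3,4) in \<open>auto simp: tensor_space_def\<close>)
qed

lemma tensor_universal:
  fixes s1 :: "'k::field \<Rightarrow> 'v \<Rightarrow> 'v::ab_group_add" and s2 :: "'k \<Rightarrow> 'w \<Rightarrow> 'w::ab_group_add"
    and s3 :: "'k \<Rightarrow> 'u \<Rightarrow> 'u::ab_group_add"
  assumes "vector_space s3" and h: "bilinear_on S s1 T s2 s3 h"
  shows "\<exists>L. Vector_Spaces.linear tscale s3 L \<and>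
    (\<forall>x\<in>S. \<forall>y\<in>T. L (tens S s1 T s2 x y) = h x y)"
proof -
  let ?t = "tens S s1 T s2"
  interpret V3: vector_space s3 by fact
  interpret P: vector_space "tscale :: 'k \<Rightarrow> ('v, 'w, 'k) tensor \<Rightarrow> ('v, 'w, 'k) tensor"
    by (rule vector_space_tscale)
  interpret K: vector_space "(*) :: 'k \<Rightarrow> 'k \<Rightarrow> 'k"
    by unfold_locales (auto simp: algebra_simps)
  interpret PU: vector_space_pair "tscale :: 'k \<Rightarrow> ('v, 'w, 'k) tensor \<Rightarrow> ('v, 'w, 'k) tensor" s3
    by unfold_locales
  interpret UK: vector_space_pair s3 "(*) :: 'k \<Rightarrow> 'k \<Rightarrow> 'k" by unfold_locales
  let ?P = "{?t x y | x y. x \<in> S \<and> y \<in> T}"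
  obtain B where B: "B \<subseteq> ?P" "P.independent B" "?P \<subseteq> P.span B"
    using P.maximal_independent_subset by blast
  have "\<forall>b\<in>B. \<exists>p. fst p \<in> S \<and> snd p \<in> T \<and> b = ?t (fst p) (snd p)" using B(1) by force
  then obtain p where p: "\<And>b. b \<in> B \<Longrightarrow> fst (p b) \<in> S \<and> snd (p b) \<in> T \<and> b = ?t (fst (p b)) (snd (p b))"
    by metis
  define g where "g b = h (fst (p b)) (snd (p b))" for b
  define L where "L = PU.construct B g"
  have L: "Vector_Spaces.linear tscale s3 L" unfolding L_def by (rule PU.linear_construct[OF B(2)])
  interpret L: Vector_Spaces.linear tscale s3 L by fact
  have "L (?t x y) = h x y" if xy: "x \<in> S" "y \<in> T" for x y
  proof (rule ccontr)
    assume ne: "L (?t x y) \<noteq> h x y"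
    let ?r = "P.representation B (?t x y)"
    let ?N = "{b. ?r b \<noteq> 0}"
    have sp: "?t x y \<in> P.span B" using B(3) xy by auto
    have NB: "b \<in> B" if "b \<in> ?N" for b using that P.representation_ne_zero by blast
    have rep: "(\<Sum>b\<in>?N. tscale (?r b) b) = ?t x y"
      by (rule P.sum_nonzero_representation_eq[OF B(2) sp])
    have Lr: "L (?t x y) = (\<Sum>b\<in>?N. s3 (?r b) (g b))"
    proof -
      have "L b = g b" if "b \<in> B" for b
        unfolding L_def by (rule PU.construct_basis[OF B(2) that])
      then show ?thesis by (subst rep[symmetric]) (auto simp: L.sum L.scale NB intro!: sum.cong)
    qed
    define d where "d = h x y - L (?t x y)"
    have "V3.independent {d}" using ne by (simp add: d_def)
    then obtain \<phi> where \<phi>: "Vector_Spaces.linear s3 (*) \<phi>" "\<phi> d = 1"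
      using UK.linear_independent_extend[of "{d}" "\<lambda>_. 1"] by auto
    interpret \<phi>: Vector_Spaces.linear s3 "(*)" \<phi> by (rule \<phi>)
    define \<beta> where "\<beta> = (\<lambda>x y. \<phi> (h x y))"
    have \<beta>: "bilinear_on S s1 T s2 (*) \<beta>"
      using h by (auto simp: bilinear_on_def linear_on_def \<beta>_def \<phi>.add \<phi>.scale)
    have ap: "(\<Sum>b\<in>A. tscale (?r b) b) \<beta> = (\<Sum>b\<in>A. ?r b * b \<beta>)" for A
      by (induction A rule: infinite_finite_induct) (auto simp: tscale_def)
    have b: "b \<beta> = \<phi> (g b)" if "b \<in> B" for b
    proof -
      have "b \<beta> = ?t (fst (p b)) (snd (p b)) \<beta>" using p[OF that] by simp
      then show ?thesis using \<beta> by (simp add: tens_def g_def \<beta>_def)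
    qed
    have "\<phi> (h x y) = ?t x y \<beta>" using \<beta> by (simp add: tens_def \<beta>_def)
    also have "\<dots> = (\<Sum>b\<in>?N. ?r b * b \<beta>)" by (subst rep[symmetric]) (rule ap)
    also have "\<dots> = (\<Sum>b\<in>?N. ?r b * \<phi> (g b))" by (intro sum.cong refl) (simp add: b NB)
    also have "\<dots> = \<phi> (L (?t x y))" by (simp add: Lr \<phi>.sum \<phi>.scale)
    finally show False using \<phi>(2) by (simp add: d_def \<phi>.diff)
  qed
  with L show ?thesis by blast
qed

lemma tensor_map_tens:
  assumes "linear_on S s1 s1' f" and "f ` S \<subseteq> S'" and "linear_on T s2 s2' g" and "g ` T \<subseteq> T'"
    and "x \<in> S" and "y \<in> T"
  shows "tensor_map S' s1' T' s2' f g (tens S s1 T s2 x y) = tens S' s1' T' s2' (f x) (g y)"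
proof -
  have "bilinear_on S s1 T s2 (*) (\<lambda>x y. \<beta> (f x) (g y))" if "bilinear_on S' s1' T' s2' (*) \<beta>" for \<beta>
    using that assms by (auto simp: bilinear_on_def linear_on_def image_subset_iff)
  then show ?thesis by (auto simp: tensor_map_def tens_def fun_eq_iff)
qed

lemma tensor_mult_tens:
  assumes "bilinear_on UNIV s UNIV s s mu"
  shows "tensor_mult s mu (tens UNIV s UNIV s x y) (tens UNIV s UNIV s x' y')
    = tens UNIV s UNIV s (mu x x') (mu y y')"
proof -
  have "bilinear_on UNIV s UNIV s (*) (\<lambda>x' y'. \<beta> (mu x x') (mu y y'))"
    "bilinear_on UNIV s UNIV s (*) (\<lambda>x y. \<beta> (mu x x') (mu y y'))"
    if "bilinear_on UNIV s UNIV s (*) \<beta>" for \<beta> x y x' y'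
    using that assms by (auto simp: bilinear_on_def linear_on_def)
  then show ?thesis by (auto simp: tensor_mult_def tens_def fun_eq_iff)
qed

lemma tensor_add:
  assumes "t \<in> tensor_space S s1 T s2"
    and "bilinear_on S s1 T s2 (*) \<beta>" and "bilinear_on S s1 T s2 (*) \<gamma>"
  shows "t (\<lambda>x y. \<beta> x y + \<gamma> x y) = t \<beta> + t \<gamma>"
proof -
  interpret P: vector_space "tscale :: 'c \<Rightarrow> (('a \<Rightarrow> 'b \<Rightarrow> 'c) \<Rightarrow> 'c) \<Rightarrow> _" by (rule vector_space_tscale)
  have "bilinear_on S s1 T s2 (*) (\<lambda>x y. \<beta> x y + \<gamma> x y)"
    using assms(2,3) by (auto simp: bilinear_on_def linear_on_def algebra_simps)
  with assms(1) show ?thesis unfolding tensor_space_def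
    by (induction rule: P.span_induct_alt)
      (auto simp: tens_def tscale_def algebra_simps assms(2,3))
qed

lemma tensor_scale:
  assumes "t \<in> tensor_space S s1 T s2" and "bilinear_on S s1 T s2 (*) \<beta>"
  shows "t (\<lambda>x y. c * \<beta> x y) = c * t \<beta>"
proof -
  interpret P: vector_space "tscale :: 'c \<Rightarrow> (('a \<Rightarrow> 'b \<Rightarrow> 'c) \<Rightarrow> 'c) \<Rightarrow> _" by (rule vector_space_tscale)
  have "bilinear_on S s1 T s2 (*) (\<lambda>x y. c * \<beta> x y)"
    using assms(2) by (auto simp: bilinear_on_def linear_on_def algebra_simps)
  with assms(1) show ?thesis unfolding tensor_space_def
    by (induction rule: P.span_induct_alt)
      (auto simp: tens_def tscale_def algebra_simps assms(2))
qed

lemma tensor_assoc_tens: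
  fixes s1 :: "'k::field \<Rightarrow> 'u \<Rightarrow> 'u::ab_group_add" and s2 :: "'k \<Rightarrow> 'v \<Rightarrow> 'v::ab_group_add"
    and s3 :: "'k \<Rightarrow> 'w \<Rightarrow> 'w::ab_group_add"
  assumes "vector_space s3" and "module.subspace s3 T"
    and "x \<in> R" and "y \<in> S" and "z \<in> T"
  shows "tensor_assoc R s1 S s2 T s3
      (tens (tensor_space R s1 S s2) tscale T s3 (tens R s1 S s2 x y) z)
    = tens R s1 (tensor_space S s2 T s3) tscale x (tens S s2 T s3 y z)"
proof -
  interpret W: vector_space s3 by fact
  have T: "a + b \<in> T" "s3 c a \<in> T" if "a \<in> T" "b \<in> T" for a b c
    using that assms(2) by (auto intro: W.subspace_add W.subspace_scale)
  let ?b = "\<lambda>\<beta> z x y. \<beta> x (tens S s2 T s3 y z)"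
  have b: "bilinear_on R s1 S s2 (*) (?b \<beta> z)"
    if "bilinear_on R s1 (tensor_space S s2 T s3) tscale (*) \<beta>" "z \<in> T" for \<beta> z
    using that bilinear_on_tens[of S s2 T s3] tens_in_tensor_space[of _ S _ T s2 s3]
    by (auto simp: bilinear_on_def linear_on_def)
  have c: "bilinear_on (tensor_space R s1 S s2) tscale T s3 (*) (\<lambda>r z. r (?b \<beta> z))"
    if \<beta>: "bilinear_on R s1 (tensor_space S s2 T s3) tscale (*) \<beta>" for \<beta>
  proof -
    interpret P: vector_space "tscale :: 'k \<Rightarrow> ('u, 'v, 'k) tensor \<Rightarrow> _" by (rule vector_space_tscale)
    have "r (?b \<beta> (z + z')) = r (?b \<beta> z) + r (?b \<beta> z')"
      and "r (?b \<beta> (s3 c z)) = c * r (?b \<beta> z)"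
      if r: "r \<in> tensor_space R s1 S s2" and z: "z \<in> T" "z' \<in> T" for r z z' c
    proof -
      have *: "tens R s1 S s2 x y (?b \<beta> (z + z')) = tens R s1 S s2 x y (?b \<beta> z) + tens R s1 S s2 x y (?b \<beta> z')"
        "tens R s1 S s2 x y (?b \<beta> (s3 c z)) = c * tens R s1 S s2 x y (?b \<beta> z)"
        if "x \<in> R" "y \<in> S" for x y
      proof -
        have e: "\<beta> x (tens S s2 T s3 y (z + z')) = \<beta> x (tens S s2 T s3 y z) + \<beta> x (tens S s2 T s3 y z')"
          "\<beta> x (tens S s2 T s3 y (s3 c z)) = c * \<beta> x (tens S s2 T s3 y z)"
          using that \<beta> z bilinear_on_tens[of S s2 T s3] tens_in_tensor_space[of _ S _ T s2 s3]
          by (auto simp: bilinear_on_def linear_on_def)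
        have ev: "tens R s1 S s2 x y (?b \<beta> w) = ?b \<beta> w x y" if "w \<in> T" for w
          using b[OF \<beta> that] by (simp add: tens_def[of R])
        show "tens R s1 S s2 x y (?b \<beta> (z + z')) = tens R s1 S s2 x y (?b \<beta> z) + tens R s1 S s2 x y (?b \<beta> z')"
          "tens R s1 S s2 x y (?b \<beta> (s3 c z)) = c * tens R s1 S s2 x y (?b \<beta> z)"
          using e T z by (simp_all add: ev)
      qed
      show "r (?b \<beta> (z + z')) = r (?b \<beta> z) + r (?b \<beta> z')"
        using r unfolding tensor_space_def
        by (induction rule: P.span_induct_alt)
          (auto simp: * tscale_def distrib_left)
      show "r (?b \<beta> (s3 c z)) = c * r (?b \<beta> z)"
        using r unfolding tensor_space_def
        by (induction rule: P.span_induct_alt)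
          (auto simp: * tscale_def distrib_left mult.left_commute)
    qed
    then show ?thesis by (auto simp: bilinear_on_def linear_on_def tscale_def)
  qed
  show ?thesis
    using assms b c
    by (auto simp: tensor_assoc_def tens_def[of R] tens_def[of "tensor_space R s1 S s2"] fun_eq_iff)
qed

lemma linear_tensor_map: "Vector_Spaces.linear tscale tscale (tensor_map S s1 T s2 f g)"
  unfolding Vector_Spaces.linear_iff
  by (auto intro: vector_space_tscale simp: tensor_map_def tscale_def fun_eq_iff)

lemma linear_tensor_assoc: "Vector_Spaces.linear tscale tscale (tensor_assoc R s1 S s2 T s3)"
  unfolding Vector_Spaces.linear_iff
  by (auto intro: vector_space_tscale simp: tensor_assoc_def tscale_def fun_eq_iff)

lemma bilinear_on_tensor_mult:
  assumes mu: "bilinear_on UNIV s UNIV s s mu"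
  shows "bilinear_on (tensor_space UNIV s UNIV s) tscale (tensor_space UNIV s UNIV s) tscale tscale
    (tensor_mult s mu)"
proof -
  have b: "bilinear_on UNIV s UNIV s (*) (\<lambda>x y. u (\<lambda>x' y'. \<beta> (mu x x') (mu y y')))"
    if u: "u \<in> tensor_space UNIV s UNIV s" and \<beta>: "bilinear_on UNIV s UNIV s (*) \<beta>" for u \<beta>
  proof -
    have b': "bilinear_on UNIV s UNIV s (*) (\<lambda>x' y'. \<beta> (mu x x') (mu y y'))" for x y
      using \<beta> mu by (auto simp: bilinear_on_def linear_on_def)
    show ?thesis
      using \<beta> mu tensor_add[OF u b' b'] tensor_scale[OF u b']
      by (simp add: bilinear_on_def linear_on_def)
  qed
  have eq: "tensor_mult s mu t u \<beta> = t (\<lambda>x y. u (\<lambda>x' y'. \<beta> (mu x x') (mu y y')))"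
    if "bilinear_on UNIV s UNIV s (*) \<beta>" for t u \<beta> using that by (simp add: tensor_mult_def)
  have z: "tensor_mult s mu t u \<beta> = 0"
    if "\<not> bilinear_on UNIV s UNIV s (*) \<beta>" for t u \<beta> using that by (simp add: tensor_mult_def)
  show ?thesis unfolding bilinear_on_def[of "tensor_space UNIV s UNIV s"] linear_on_def
  proof (intro conjI ballI allI ext)
    fix t u v c \<beta>
    assume t: "t \<in> tensor_space UNIV s UNIV s" and u: "u \<in> tensor_space UNIV s UNIV s"
      and v: "v \<in> tensor_space UNIV s UNIV s"
    show "tensor_mult s mu t (u + v) \<beta> = (tensor_mult s mu t u + tensor_mult s mu t v) \<beta>"
    proof (cases "bilinear_on UNIV s UNIV s (*) \<beta>")
      case True
      show ?thesis using tensor_add[OF t b[OF u True] b[OF v True]] by (simp add: eq[OF True])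
    qed (simp add: z)
  next
    fix t u c \<beta>
    assume t: "t \<in> tensor_space UNIV s UNIV s" and u: "u \<in> tensor_space UNIV s UNIV s"
    show "tensor_mult s mu t (tscale c u) \<beta> = tscale c (tensor_mult s mu t u) \<beta>"
    proof (cases "bilinear_on UNIV s UNIV s (*) \<beta>")
      case True
      show ?thesis using tensor_scale[OF t b[OF u True]] by (simp add: eq[OF True] tscale_def)
    qed (simp add: z tscale_def)
  qed (simp_all add: tensor_mult_def tscale_def)
qed


section \<open>Hom-algebras, hom-coalgebras and hom-bialgebras\<close>

locale hom_associative_algebra = vector_space smul
  for smul :: "'k::field \<Rightarrow> 'v::ab_group_add \<Rightarrow> 'v" +
  fixes mu :: "'v \<Rightarrow> 'v \<Rightarrow> 'v" and alpha :: "'v \<Rightarrow> 'v"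
  assumes mu_bilinear: "bilinear_on UNIV smul UNIV smul smul mu"
    and alpha_linear: "Vector_Spaces.linear smul smul alpha"
    and multiplicative: "alpha (mu x y) = mu (alpha x) (alpha y)"
    and hom_assoc: "mu (alpha x) (mu y z) = mu (mu x y) (alpha z)"

locale unital_hom_associative_algebra = hom_associative_algebra smul mu alpha
  for smul :: "'k::field \<Rightarrow> 'v::ab_group_add \<Rightarrow> 'v" and mu and eta :: "'k \<Rightarrow> 'v" and alpha +
  assumes eta_linear: "Vector_Spaces.linear (*) smul eta"
    and unit_right: "mu x (eta 1) = x"
    and unit_left: "mu (eta 1) x = x"

text \<open>The two sides of hom-coassociativity live in \<open>(V \<otimes> V) \<otimes> V\<close> and \<open>V \<otimes> (V \<otimes> V)\<close>, which
  are identified by \<open>tensor_assoc\<close>.\<close>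

locale hom_coassociative_coalgebra = vector_space smul
  for smul :: "'k::field \<Rightarrow> 'v::ab_group_add \<Rightarrow> 'v" +
  fixes Delta :: "'v \<Rightarrow> ('v, 'v, 'k) tensor" and alpha :: "'v \<Rightarrow> 'v"
  assumes Delta_in: "Delta x \<in> tensor_space UNIV smul UNIV smul"
    and Delta_linear: "Vector_Spaces.linear smul tscale Delta"
    and coalpha_linear: "Vector_Spaces.linear smul smul alpha"
    and comultiplicative:
      "tensor_map UNIV smul UNIV smul alpha alpha (Delta x) = Delta (alpha x)"
    and hom_coassoc:
      "tensor_map UNIV smul (tensor_space UNIV smul UNIV smul) tscale alpha Delta (Delta x)
       = tensor_assoc UNIV smul UNIV smul UNIV smul
          (tensor_map (tensor_space UNIV smul UNIV smul) tscale UNIV smul Delta alpha (Delta x))"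

text \<open>\<open>V\<close> is identified with \<open>\<bbbK> \<otimes> V\<close> and \<open>V \<otimes> \<bbbK>\<close> by \<open>v \<mapsto> 1 \<otimes> v\<close> and
  \<open>v \<mapsto> v \<otimes> 1\<close>.\<close>

locale counital_hom_coassociative_coalgebra = hom_coassociative_coalgebra smul Delta alpha
  for smul :: "'k::field \<Rightarrow> 'v::ab_group_add \<Rightarrow> 'v" and Delta and eps :: "'v \<Rightarrow> 'k" and alpha +
  assumes eps_linear: "Vector_Spaces.linear smul (*) eps"
    and counit_left: "tensor_map UNIV (*) UNIV smul eps alpha (Delta x)
      = tens UNIV (*) UNIV smul 1 (alpha (alpha x))"
    and counit_right: "tensor_map UNIV smul UNIV (*) alpha eps (Delta x)
      = tens UNIV smul UNIV (*) (alpha (alpha x)) 1"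

locale unital_hom_bialgebra =
  unital_hom_associative_algebra smul mu eta alpha +
  counital_hom_coassociative_coalgebra smul Delta eps alpha
  for smul :: "'k::field \<Rightarrow> 'v::ab_group_add \<Rightarrow> 'v" and mu and eta and Delta and eps and alpha +
  assumes Delta_mu: "Delta (mu x y) = tensor_mult smul mu (Delta x) (Delta y)"
    and eps_mu: "eps (mu x y) = eps x * eps y"
    and eps_alpha: "eps (alpha x) = eps x"


section \<open>The construction \<open>\<K>\<^sub>1\<close>\<close>

text \<open>\<open>V \<oplus> \<bbbK>e\<^sub>1\<close> is the type \<open>'v \<times> 'k\<close>, with \<open>(v, a)\<close> standing for \<open>v + a e\<^sub>1\<close>. Each map
  is the linear (bilinear) extension of its prescribed values, see \<open>K1_clauses\<close>.\<close>

definition K1_incl :: "'v \<Rightarrow> 'v \<times> 'k::field"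
  where "K1_incl v = (v, 0)"

definition K1_e1 :: "'v::ab_group_add \<times> 'k::field"
  where "K1_e1 = (0, 1)"

abbreviation K1_scale :: "('k \<Rightarrow> 'v \<Rightarrow> 'v) \<Rightarrow> 'k \<Rightarrow> 'v::ab_group_add \<times> 'k \<Rightarrow> 'v \<times> 'k::field"
  where "K1_scale smul \<equiv> module_prod.scale smul (*)"

definition K1_mu :: "('k \<Rightarrow> 'v \<Rightarrow> 'v) \<Rightarrow> ('v \<Rightarrow> 'v \<Rightarrow> 'v)
    \<Rightarrow> 'v::ab_group_add \<times> 'k \<Rightarrow> 'v \<times> 'k \<Rightarrow> 'v \<times> 'k::field"
  where "K1_mu smul mu p q = (case (p, q) of
    ((x, a), (y, b)) \<Rightarrow> (mu x y + smul b x + smul a y, a * b))"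

definition K1_eta :: "('k \<Rightarrow> 'v \<Rightarrow> 'v) \<Rightarrow> 'k \<Rightarrow> 'v::ab_group_add \<times> 'k::field"
  where "K1_eta smul c = K1_scale smul c K1_e1"

definition K1_Delta :: "('k \<Rightarrow> 'v \<Rightarrow> 'v) \<Rightarrow> ('k \<Rightarrow> 'v) \<Rightarrow> ('v \<Rightarrow> 'v)
    \<Rightarrow> 'v::ab_group_add \<times> 'k \<Rightarrow> ('v \<times> 'k, 'v \<times> 'k, 'k::field) tensor"
  where "K1_Delta smul eta alpha p = (case p of (x, a) \<Rightarrow>
    let tens' = tens UNIV (K1_scale smul) UNIV (K1_scale smul)
    in tscale a (tens' K1_e1 K1_e1)
      + (tens' (K1_incl (alpha x)) K1_e1 + tens' K1_e1 (K1_incl (alpha x))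
        - tens' (K1_incl (eta 1)) (K1_incl (alpha x))))"

definition K1_eps :: "'v \<times> 'k \<Rightarrow> 'k::field"
  where "K1_eps p = snd p"

text \<open>The prescriptions \<open>\<alpha>\<^sub>1(x) = \<alpha>(x)\<close> on \<open>V\<close> and \<open>\<alpha>\<^sub>1(e\<^sub>1) = e\<^sub>1\<close> already determine
  \<open>\<alpha>\<^sub>1\<close>. The further prescription \<open>\<alpha>\<^sub>1(e\<^sub>2) = e\<^sub>2\<close> is compatible with them only if
  \<open>\<alpha>(e\<^sub>2) = e\<^sub>2\<close>, and therefore has to be imposed as a condition where the construction
  is used.\<close>

definition K1_alpha :: "('v \<Rightarrow> 'v) \<Rightarrow> 'v \<times> 'k \<Rightarrow> 'v \<times> 'k::field"
  where "K1_alpha alpha p = (alpha (fst p), snd p)"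

context unital_hom_associative_algebra
begin

abbreviation (input) "tens\<^sub>1 \<equiv> tens UNIV (K1_scale smul) UNIV (K1_scale smul)"

lemma vector_space_K1: "vector_space (K1_scale smul)"
proof -
  interpret k: vector_space "(*) :: 'k \<Rightarrow> 'k \<Rightarrow> 'k" by unfold_locales (auto simp: algebra_simps)
  interpret vector_space_prod smul "(*) :: 'k \<Rightarrow> 'k \<Rightarrow> 'k" by unfold_locales
  show ?thesis by (rule p.vector_space_axioms)
qed

lemma K1_scale_Pair: "K1_scale smul c (x, a) = (smul c x, c * a)"
proof -
  interpret k: vector_space "(*) :: 'k \<Rightarrow> 'k \<Rightarrow> 'k" by unfold_locales (auto simp: algebra_simps)
  interpret vector_space_prod smul "(*) :: 'k \<Rightarrow> 'k \<Rightarrow> 'k" by unfold_locales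
  show ?thesis by (rule scale_prod)
qed

lemma K1_decomp: "(x, a) = K1_incl x + K1_scale smul a K1_e1"
  by (simp add: K1_incl_def K1_e1_def K1_scale_Pair)

lemma mu_zero: "mu 0 x = 0" "mu x 0 = 0"
proof -
  have "mu (0 + 0) x = mu 0 x + mu 0 x" "mu x (0 + 0) = mu x 0 + mu x 0"
    using mu_bilinear unfolding bilinear_on_def linear_on_def by blast+
  then show "mu 0 x = 0" "mu x 0 = 0" by simp_all
qed

lemma alpha_0: "alpha 0 = 0"
proof -
  interpret Vector_Spaces.linear smul smul alpha by (rule alpha_linear)
  show ?thesis by (rule zero)
qed

lemma K1_clauses:
  "K1_mu smul mu K1_e1 p = p" "K1_mu smul mu p K1_e1 = p"
  "K1_mu smul mu (K1_incl x) (K1_incl y) = K1_incl (mu x y)"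
  "K1_eta smul 1 = K1_e1"
  "K1_Delta smul eta alpha K1_e1 = tens\<^sub>1 K1_e1 K1_e1"
  "K1_Delta smul eta alpha (K1_incl x) = tens\<^sub>1 (K1_incl (alpha x)) K1_e1
    + tens\<^sub>1 K1_e1 (K1_incl (alpha x)) - tens\<^sub>1 (K1_incl (eta 1)) (K1_incl (alpha x))"
  "K1_eps K1_e1 = 1" "K1_eps (K1_incl x) = 0"
  "K1_alpha alpha K1_e1 = K1_e1" "K1_alpha alpha (K1_incl x) = K1_incl (alpha x)"
proof -
  have z: "tens\<^sub>1 p (K1_incl 0) = 0" "tens\<^sub>1 (K1_incl 0) p = 0" for p
  proof -
    have "tens\<^sub>1 p (0 + 0) = tens\<^sub>1 p 0 + tens\<^sub>1 p 0" "tens\<^sub>1 (0 + 0) p = tens\<^sub>1 0 p + tens\<^sub>1 0 p"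
      using bilinear_on_tens[of UNIV "K1_scale smul" UNIV "K1_scale smul"]
      unfolding bilinear_on_def linear_on_def by blast+
    then show "tens\<^sub>1 p (K1_incl 0) = 0" "tens\<^sub>1 (K1_incl 0) p = 0"
      by (simp_all add: K1_incl_def zero_prod_def[symmetric])
  qed
  show "K1_Delta smul eta alpha K1_e1 = tens\<^sub>1 K1_e1 K1_e1"
    by (simp add: K1_Delta_def K1_e1_def alpha_0 z tscale_def)
  show "K1_Delta smul eta alpha (K1_incl x) = tens\<^sub>1 (K1_incl (alpha x)) K1_e1
    + tens\<^sub>1 K1_e1 (K1_incl (alpha x)) - tens\<^sub>1 (K1_incl (eta 1)) (K1_incl (alpha x))"
    unfolding K1_Delta_def Let_def by (simp add: K1_incl_def tscale_def zero_fun_def[symmetric])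
qed (auto simp: K1_mu_def K1_e1_def K1_incl_def K1_eta_def K1_eps_def K1_alpha_def K1_scale_Pair
      mu_zero alpha_0 split: prod.split)

end

end

theory Submission
  imports Defs
begin

text \<open>
  The requirement \<open>\<alpha>(e\<^sub>2) = e\<^sub>2\<close> is very strong. Hom-associativity applied to \<open>e\<^sub>2, e\<^sub>2, z\<close> reads
  \<open>\<alpha>(e\<^sub>2) z = \<alpha>(z)\<close>, so \<open>\<alpha>\<close> is the identity (\<open>alpha_ident\<close>), \<open>V\<close> is an associative unital
  algebra, and \<open>V \<oplus> \<bbbK>e\<^sub>1\<close> is its unitization, again with the identity as twist. What has to be
  shown is that this is an ordinary bialgebra.

  The element \<open>f = e\<^sub>1 - e\<^sub>2\<close> explains the comultiplication. Since \<open>e\<^sub>2\<close> is the unit of the ideal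
  \<open>V\<close>, \<open>f\<close> is an idempotent that annihilates \<open>V\<close>, whence \<open>p f = f p = \<epsilon>\<^sub>1(p) f\<close> for every \<open>p\<close>.
  Writing \<open>\<pi>(p) = p - \<epsilon>\<^sub>1(p) e\<^sub>1\<close> for the projection onto \<open>V\<close>, the comultiplication becomes the
  single formula
  \<open>\<Delta>\<^sub>1(p) = p \<otimes> e\<^sub>1 + f \<otimes> \<pi>(p)\<close> (\<open>K1_Delta_eq\<close>).
  As \<open>\<pi>(f) = f - e\<^sub>1\<close>, it gives \<open>\<Delta>\<^sub>1(f) = f \<otimes> f\<close> (\<open>K1_Delta_idem\<close>). Hence both iterated
  comultiplications of \<open>p\<close> are
  \<open>p \<otimes> e\<^sub>1 \<otimes> e\<^sub>1 + f \<otimes> \<pi>(p) \<otimes> e\<^sub>1 + f \<otimes> f \<otimes> \<pi>(p)\<close>.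
  For multiplicativity, the four terms of \<open>\<Delta>\<^sub>1(p) \<bullet> \<Delta>\<^sub>1(q)\<close> are
  \<open>pq \<otimes> e\<^sub>1\<close>, \<open>pf \<otimes> \<pi>(q)\<close>, \<open>fq \<otimes> \<pi>(p)\<close> and \<open>f \<otimes> \<pi>(p)\<pi>(q)\<close>; the last three add up to
  \<open>f \<otimes> (\<epsilon>\<^sub>1(p) \<pi>(q) + \<epsilon>\<^sub>1(q) \<pi>(p) + \<pi>(p)\<pi>(q)) = f \<otimes> \<pi>(pq)\<close>.
\<close>

section \<open>Linearity of the tensor operations\<close>

lemma linear_on_UNIV_iff:
  assumes "vector_space s1" and "vector_space s2"
  shows "linear_on UNIV s1 s2 f \<longleftrightarrow> Vector_Spaces.linear s1 s2 f"
  using assms by (auto simp: linear_on_def Vector_Spaces.linear_iff)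

lemma tens_bilinear:
  assumes "x \<in> S" and "y \<in> T"
  shows "x' \<in> S \<Longrightarrow> tens S s1 T s2 (x + x') y = tens S s1 T s2 x y + tens S s1 T s2 x' y"
    and "y' \<in> T \<Longrightarrow> tens S s1 T s2 x (y + y') = tens S s1 T s2 x y + tens S s1 T s2 x y'"
    and "tens S s1 T s2 (s1 c x) y = tscale c (tens S s1 T s2 x y)"
    and "tens S s1 T s2 x (s2 c y) = tscale c (tens S s1 T s2 x y)"
  using bilinear_on_tens[of S s1 T s2] assms unfolding bilinear_on_def linear_on_def by blast+

lemma tensor_map_add:
  "tensor_map S s1 T s2 f g (t + u) = tensor_map S s1 T s2 f g t + tensor_map S s1 T s2 f g u"
  using linear_tensor_map[of S s1 T s2 f g] by (simp add: Vector_Spaces.linear_iff)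

lemma tensor_assoc_add:
  "tensor_assoc R s1 S s2 T s3 (t + u)
    = tensor_assoc R s1 S s2 T s3 t + tensor_assoc R s1 S s2 T s3 u"
  using linear_tensor_assoc[of R s1 S s2 T s3] by (simp add: Vector_Spaces.linear_iff)

lemma tensor_space_add:
  fixes t u :: "('v::ab_group_add, 'w::ab_group_add, 'k::field) tensor"
  assumes "t \<in> tensor_space S s1 T s2" and "u \<in> tensor_space S s1 T s2"
  shows "t + u \<in> tensor_space S s1 T s2"
proof -
  interpret P: vector_space "tscale :: 'k \<Rightarrow> ('v, 'w, 'k) tensor \<Rightarrow> _" by (rule vector_space_tscale)
  show ?thesis using assms unfolding tensor_space_def by (rule P.span_add)
qed

lemma tensor_mult_add:
  assumes "bilinear_on UNIV s UNIV s s mu"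
    and "t \<in> tensor_space UNIV s UNIV s" and "t' \<in> tensor_space UNIV s UNIV s"
    and "u \<in> tensor_space UNIV s UNIV s"
  shows "tensor_mult s mu (t + t') u = tensor_mult s mu t u + tensor_mult s mu t' u"
    and "tensor_mult s mu u (t + t') = tensor_mult s mu u t + tensor_mult s mu u t'"
  using bilinear_on_tensor_mult[OF assms(1)] assms(2-) unfolding bilinear_on_def linear_on_def
  by blast+

lemma vector_space_field: "vector_space ((*) :: 'k::field \<Rightarrow> 'k \<Rightarrow> 'k)"
  by unfold_locales (auto simp: algebra_simps)

section \<open>The unitization and its idempotent \<open>e\<^sub>1 - e\<^sub>2\<close>\<close>

locale unit_preserving_hom_associative_algebra = unital_hom_associative_algebra smul mu eta alpha
  for smul :: "'k::field \<Rightarrow> 'v::ab_group_add \<Rightarrow> 'v" and mu and eta and alpha +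
  assumes alpha_unit: "alpha (eta 1) = eta 1"
begin

text \<open>Hom-associativity with two units on the left turns multiplication by \<open>\<alpha>(e\<^sub>2) = e\<^sub>2\<close> into
  application of \<open>\<alpha>\<close>.\<close>

lemma alpha_ident: "alpha z = z"
  using hom_assoc[of "eta 1" "eta 1" z] by (simp add: alpha_unit unit_left)

lemma K1_alpha_id: "K1_alpha alpha = id"
  by (simp add: fun_eq_iff K1_alpha_def alpha_ident)

lemma mu_assoc: "mu x (mu y z) = mu (mu x y) z"
  using hom_assoc[of x y z] by (simp add: alpha_ident)

lemma mu_add: "mu (x + y) z = mu x z + mu y z" "mu z (x + y) = mu z x + mu z y"
  and mu_scale: "mu (smul c x) z = smul c (mu x z)" "mu z (smul c x) = smul c (mu z x)"
  using mu_bilinear by (auto simp: bilinear_on_def linear_on_def)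

lemma mu_minus_unit: "mu (- eta 1) x = - x" "mu x (- eta 1) = - x"
proof -
  have "mu (- eta 1) x + mu (eta 1) x = 0" "mu x (- eta 1) + mu x (eta 1) = 0"
    by (simp_all add: mu_add[symmetric] mu_zero)
  then show "mu (- eta 1) x = - x" "mu x (- eta 1) = - x"
    by (simp_all add: unit_left unit_right eq_neg_iff_add_eq_0)
qed

lemma K1_mu_bilinear:
  "bilinear_on UNIV (K1_scale smul) UNIV (K1_scale smul) (K1_scale smul) (K1_mu smul mu)"
  by (auto simp: bilinear_on_def linear_on_def K1_mu_def K1_scale_Pair mu_add mu_scale
      scale_right_distrib scale_left_distrib algebra_simps)

lemma K1_mu_assoc:
  "K1_mu smul mu p (K1_mu smul mu q r) = K1_mu smul mu (K1_mu smul mu p q) r"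
  by (cases p; cases q; cases r)
    (simp add: K1_mu_def mu_add mu_scale mu_assoc scale_right_distrib ac_simps)

definition idem :: "'v \<times> 'k"
  where "idem = K1_e1 - K1_incl (eta 1)"

text \<open>The unit \<open>e\<^sub>2\<close> of \<open>V\<close> and the unit \<open>e\<^sub>1\<close> of \<open>V \<oplus> \<bbbK>e\<^sub>1\<close> act alike on \<open>V\<close>, so their
  difference kills \<open>V\<close> and only the \<open>e\<^sub>1\<close>-coordinate of the other factor survives.\<close>

lemma K1_mu_idem:
  "K1_mu smul mu idem p = K1_scale smul (snd p) idem"
  "K1_mu smul mu p idem = K1_scale smul (snd p) idem"
  by (cases p; simp add: idem_def K1_e1_def K1_incl_def K1_mu_def K1_scale_Pair mu_minus_unit)+

text \<open>For \<open>p = x \<in> V\<close> this collects the two terms of \<open>\<Delta>\<^sub>1(x)\<close> that end in \<open>x\<close>; the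
  contribution of \<open>a e\<^sub>1\<close> is \<open>a e\<^sub>1 \<otimes> e\<^sub>1\<close>, which the first summand absorbs. In this form
  \<open>\<Delta>\<^sub>1\<close> needs no case distinction between \<open>V\<close> and \<open>e\<^sub>1\<close>.\<close>

lemma K1_Delta_eq: "K1_Delta smul eta alpha p = tens\<^sub>1 p K1_e1 + tens\<^sub>1 idem (K1_incl (fst p))"
proof -
  obtain x a where p: "p = (x, a)" by (cases p)
  have "tens\<^sub>1 K1_e1 (K1_incl x)
      = tens\<^sub>1 idem (K1_incl x) + tens\<^sub>1 (K1_incl (eta 1)) (K1_incl x)"
    by (subst tens_bilinear(1)[symmetric]) (simp_all add: idem_def)
  moreover have "tens\<^sub>1 p K1_e1 = tens\<^sub>1 (K1_incl x) K1_e1 + tscale a (tens\<^sub>1 K1_e1 K1_e1)"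
    unfolding p K1_decomp by (simp add: tens_bilinear)
  ultimately show ?thesis
    by (simp add: p K1_Delta_def Let_def alpha_ident algebra_simps)
qed

text \<open>The difference \<open>e\<^sub>1 - e\<^sub>2\<close> is grouplike because its \<open>V\<close>-part is \<open>- e\<^sub>2\<close>: the two tensors
  \<open>f \<otimes> e\<^sub>1\<close> and \<open>f \<otimes> (- e\<^sub>2)\<close> share the left factor \<open>f\<close>.\<close>

lemma K1_Delta_idem: "K1_Delta smul eta alpha idem = tens\<^sub>1 idem idem"
proof -
  have "K1_e1 + K1_incl (fst idem) = idem"
    by (simp add: idem_def K1_e1_def K1_incl_def)
  then show ?thesis by (simp add: K1_Delta_eq tens_bilinear(2)[symmetric])
qed

lemma K1_Delta_incl:
  "K1_Delta smul eta alpha (K1_incl x) = tens\<^sub>1 (K1_incl x) K1_e1 + tens\<^sub>1 idem (K1_incl x)"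
  by (simp add: K1_Delta_eq K1_incl_def)

section \<open>The bialgebra axioms\<close>

lemma K1_Delta_in: "K1_Delta smul eta alpha p \<in> tensor_space UNIV (K1_scale smul) UNIV (K1_scale smul)"
  by (simp add: K1_Delta_eq tensor_space_add tens_in_tensor_space)

lemma K1_Delta_linear: "Vector_Spaces.linear (K1_scale smul) tscale (K1_Delta smul eta alpha)"
proof -
  interpret T: vector_space "tscale :: 'k \<Rightarrow> ('v \<times> 'k, 'v \<times> 'k, 'k) tensor \<Rightarrow> _"
    by (rule vector_space_tscale)
  have "K1_incl (x + y) = K1_incl x + (K1_incl y :: 'v \<times> 'k)"
    and "K1_incl (fst (K1_scale smul c p)) = K1_scale smul c (K1_incl (fst p))"
    for x y :: 'v and p :: "'v \<times> 'k" and c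
    by (cases p; simp add: K1_incl_def K1_scale_Pair)+
  then show ?thesis unfolding Vector_Spaces.linear_iff
    by (simp add: vector_space_K1 vector_space_tscale K1_Delta_eq tens_bilinear
        T.scale_right_distrib add_ac)
qed

lemma K1_eps_linear: "Vector_Spaces.linear (K1_scale smul) (*) K1_eps"
  using vector_space_K1 vector_space_field
  by (auto simp: Vector_Spaces.linear_iff K1_eps_def K1_scale_Pair)

lemma K1_linear_on:
  "linear_on UNIV (K1_scale smul) (K1_scale smul) id"
  "linear_on UNIV (K1_scale smul) tscale (K1_Delta smul eta alpha)"
  "linear_on UNIV (K1_scale smul) (*) K1_eps"
  using K1_Delta_linear K1_eps_linear
  by (auto simp: linear_on_UNIV_iff vector_space_K1 vector_space_tscale vector_space_field
      linear_on_def[of _ _ _ id])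

lemma K1_comultiplicative:
  "tensor_map UNIV (K1_scale smul) UNIV (K1_scale smul) id id (K1_Delta smul eta alpha p)
    = K1_Delta smul eta alpha p"
  by (simp add: K1_Delta_eq tensor_map_add tensor_map_tens[OF K1_linear_on(1) _ K1_linear_on(1)])

text \<open>Expanding the right factors of \<open>p \<otimes> e\<^sub>1 + f \<otimes> \<pi>(p)\<close> with \<open>\<Delta>\<^sub>1\<close>, and then expanding the
  left ones instead, leads to the same three-term sum, because \<open>e\<^sub>1\<close> and \<open>f\<close> are grouplike.\<close>

lemma K1_coassoc:
  defines "s \<equiv> K1_scale smul" and "D \<equiv> K1_Delta smul eta alpha"
  shows "tensor_map UNIV s (tensor_space UNIV s UNIV s) tscale id D (D p)
    = tensor_assoc UNIV s UNIV s UNIV s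
        (tensor_map (tensor_space UNIV s UNIV s) tscale UNIV s D id (D p))"
proof -
  let ?W = "tensor_space UNIV s UNIV s"
  let ?t = "tens UNIV s UNIV s" and ?tl = "tens ?W tscale UNIV s" and ?tr = "tens UNIV s ?W tscale"
  let ?\<pi> = "K1_incl (fst p)"
  have W: "?t x y \<in> ?W" for x y by (simp add: tens_in_tensor_space)
  have D: "D ` UNIV \<subseteq> ?W" using K1_Delta_in by (auto simp: D_def s_def)
  interpret S: vector_space s unfolding s_def by (rule vector_space_K1)
  note id = K1_linear_on(1)[folded s_def] and lin = K1_linear_on(2)[folded s_def D_def]
  note D_eq = K1_Delta_eq[folded s_def D_def] and D_incl = K1_Delta_incl[folded s_def D_def]
    and D_idem = K1_Delta_idem[folded s_def D_def]
  have D_e1: "D K1_e1 = ?t K1_e1 K1_e1" by (simp add: D_def s_def K1_clauses)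
  have assoc: "tensor_assoc UNIV s UNIV s UNIV s (?tl (?t x y) z) = ?tr x (?t y z)" for x y z
    by (rule tensor_assoc_tens) (simp_all add: S.vector_space_axioms)
  have "tensor_map UNIV s ?W tscale id D (D p) = ?tr p (D K1_e1) + ?tr idem (D ?\<pi>)"
    by (simp add: D_eq[of p] tensor_map_add tensor_map_tens[OF id _ lin D])
  also have "\<dots> = ?tr p (?t K1_e1 K1_e1) + (?tr idem (?t ?\<pi> K1_e1) + ?tr idem (?t idem ?\<pi>))"
    by (simp add: D_e1 D_incl tens_bilinear W)
  also have "\<dots> = tensor_assoc UNIV s UNIV s UNIV s (?tl (D p) K1_e1 + ?tl (D idem) ?\<pi>)"
    by (simp add: D_eq[of p] D_idem tens_bilinear W tensor_assoc_add assoc add.assoc)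
  also have "?tl (D p) K1_e1 + ?tl (D idem) ?\<pi> = tensor_map ?W tscale UNIV s D id (D p)"
    by (simp add: D_eq[of p] tensor_map_add tensor_map_tens[OF lin D id])
  finally show ?thesis .
qed

text \<open>Since \<open>\<epsilon>\<^sub>1(f) = 1\<close>, applying \<open>\<epsilon>\<^sub>1\<close> to the left factors leaves
  \<open>\<epsilon>\<^sub>1(p) e\<^sub>1 + \<pi>(p) = p\<close>; applying it to the right factors leaves only \<open>p\<close>, because \<open>\<epsilon>\<^sub>1\<close>
  vanishes on \<open>V\<close>.\<close>

lemma K1_counit_left:
  "tensor_map UNIV (*) UNIV (K1_scale smul) K1_eps id (K1_Delta smul eta alpha p)
    = tens UNIV (*) UNIV (K1_scale smul) 1 p"
proof -
  let ?t = "tens UNIV (*) UNIV (K1_scale smul)"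
  have "tensor_map UNIV (*) UNIV (K1_scale smul) K1_eps id (K1_Delta smul eta alpha p)
      = ?t (snd p * 1) K1_e1 + ?t 1 (K1_incl (fst p))"
    by (simp add: K1_Delta_eq tensor_map_add tensor_map_tens[OF K1_linear_on(3) _ K1_linear_on(1)])
      (simp add: K1_eps_def idem_def K1_e1_def K1_incl_def)
  also have "\<dots> = ?t 1 (K1_incl (fst p) + K1_scale smul (snd p) K1_e1)"
    by (simp only: tens_bilinear UNIV_I add.commute)
  finally show ?thesis by (simp add: K1_decomp[symmetric])
qed

lemma K1_counit_right:
  "tensor_map UNIV (K1_scale smul) UNIV (*) id K1_eps (K1_Delta smul eta alpha p)
    = tens UNIV (K1_scale smul) UNIV (*) p 1"
proof -
  let ?t = "tens UNIV (K1_scale smul) UNIV (*)"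
  \<comment> \<open>The zero of the field is written as a scalar multiple, so that it can be pulled out.\<close>
  have "?t idem (0 * 0) = tscale 0 (?t idem 0)" by (rule tens_bilinear) simp_all
  then have "?t idem 0 = 0" by (simp add: tscale_def zero_fun_def)
  then show ?thesis
    by (simp add: K1_Delta_eq tensor_map_add tensor_map_tens[OF K1_linear_on(1) _ K1_linear_on(3)]
        K1_clauses)
qed

text \<open>The idempotent \<open>f\<close> turns the left factors \<open>p f\<close> and \<open>f q\<close> of the mixed terms into scalar
  multiples of \<open>f\<close>; moved to the right factor, these scalars are the coefficients in the expansion
  of the \<open>V\<close>-part of \<open>p q\<close>.\<close>

lemma K1_Delta_mu:
  "K1_Delta smul eta alpha (K1_mu smul mu p q)
    = tensor_mult (K1_scale smul) (K1_mu smul mu) (K1_Delta smul eta alpha p) (K1_Delta smul eta alpha q)"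
proof -
  let ?m = "K1_mu smul mu" and ?s = "K1_scale smul"
  let ?\<pi> = "\<lambda>p. K1_incl (fst p) :: 'v \<times> 'k"
  have \<pi>: "?\<pi> (?m p q) = ?s (snd p) (?\<pi> q) + ?s (snd q) (?\<pi> p) + ?m (?\<pi> p) (?\<pi> q)"
    by (cases p; cases q) (simp add: K1_mu_def K1_incl_def K1_scale_Pair add_ac)
  have idem: "?m idem idem = idem"
    by (simp add: K1_mu_idem) (simp add: idem_def K1_e1_def K1_incl_def K1_scale_Pair)
  have "tensor_mult ?s ?m (K1_Delta smul eta alpha p) (K1_Delta smul eta alpha q)
      = tens\<^sub>1 (?m p q) K1_e1 + tens\<^sub>1 (?m p idem) (?\<pi> q)
        + (tens\<^sub>1 (?m idem q) (?\<pi> p) + tens\<^sub>1 idem (?m (?\<pi> p) (?\<pi> q)))"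
    by (simp add: K1_Delta_eq tensor_mult_add[OF K1_mu_bilinear] tensor_mult_tens[OF K1_mu_bilinear]
        tensor_space_add tens_in_tensor_space K1_clauses idem add_ac)
  also have "\<dots> = tens\<^sub>1 (?m p q) K1_e1 + tens\<^sub>1 idem (?\<pi> (?m p q))"
    by (simp add: \<pi> K1_mu_idem tens_bilinear add.assoc)
  finally show ?thesis by (simp add: K1_Delta_eq)
qed

lemma K1_eta_linear: "Vector_Spaces.linear (*) (K1_scale smul) (K1_eta smul)"
  using vector_space_K1 vector_space_field
  by (auto simp: Vector_Spaces.linear_iff K1_eta_def K1_e1_def K1_scale_Pair algebra_simps)

lemma K1_unital_hom_bialgebra:
  "unital_hom_bialgebra (K1_scale smul) (K1_mu smul mu) (K1_eta smul)
    (K1_Delta smul eta alpha) K1_eps (K1_alpha alpha)"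
proof -
  interpret S: vector_space "K1_scale smul" by (rule vector_space_K1)
  have id: "Vector_Spaces.linear (K1_scale smul) (K1_scale smul) id"
    using vector_space_K1 by (simp add: Vector_Spaces.linear_iff)
  show ?thesis unfolding K1_alpha_id
  proof (intro unital_hom_bialgebra.intro unital_hom_associative_algebra.intro
      hom_associative_algebra.intro counital_hom_coassociative_coalgebra.intro
      hom_coassociative_coalgebra.intro S.vector_space_axioms)
    show "hom_associative_algebra_axioms (K1_scale smul) (K1_mu smul mu) id"
      by (rule hom_associative_algebra_axioms.intro) (simp_all add: K1_mu_bilinear id K1_mu_assoc)
    show "unital_hom_associative_algebra_axioms (K1_scale smul) (K1_mu smul mu) (K1_eta smul)"
      by (rule unital_hom_associative_algebra_axioms.intro) (simp_all add: K1_eta_linear K1_clauses)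
    show "hom_coassociative_coalgebra_axioms (K1_scale smul) (K1_Delta smul eta alpha) id"
      by (rule hom_coassociative_coalgebra_axioms.intro)
        (simp_all only: K1_Delta_in K1_Delta_linear id K1_comultiplicative K1_coassoc id_apply)
    show "counital_hom_coassociative_coalgebra_axioms (K1_scale smul) (K1_Delta smul eta alpha)
        K1_eps id"
      by (rule counital_hom_coassociative_coalgebra_axioms.intro)
        (simp_all add: K1_eps_linear K1_counit_left K1_counit_right)
    show "unital_hom_bialgebra_axioms (K1_scale smul) (K1_mu smul mu) (K1_Delta smul eta alpha)
        K1_eps id"
      by (rule unital_hom_bialgebra_axioms.intro)
        (simp only: K1_Delta_mu, simp_all add: K1_eps_def K1_mu_def split: prod.split)
  qed
qed

end

theorem proposition3p1:
  fixes smul :: "'k::field \<Rightarrow> 'v::ab_group_add \<Rightarrow> 'v"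
    and mu :: "'v \<Rightarrow> 'v \<Rightarrow> 'v" and eta :: "'k \<Rightarrow> 'v" and alpha :: "'v \<Rightarrow> 'v"
  assumes "unital_hom_associative_algebra smul mu eta alpha"
    and "(K1_alpha alpha (K1_incl (eta 1)) :: 'v \<times> 'k) = K1_incl (eta 1)"
  shows "unital_hom_bialgebra (K1_scale smul) (K1_mu smul mu) (K1_eta smul)
    (K1_Delta smul eta alpha) K1_eps (K1_alpha alpha)"
proof -
  have "alpha (eta 1) = eta 1" using assms(2) by (simp add: K1_alpha_def K1_incl_def)
  with assms(1) interpret unit_preserving_hom_associative_algebra smul mu eta alpha
    by (intro unit_preserving_hom_associative_algebra.intro
        unit_preserving_hom_associative_algebra_axioms.intro)
  show ?thesis by (rule K1_unital_hom_bialgebra)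
qed

end
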